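(* Fix $\xi>0$ and $\bar z=(\bar x,\bar y)\in Z^\star$. The following are equivalent. (a) (Uniform local quadratic growth.) There are a neighborhood $V$ of $\bar z$ and a constant $\alpha_\xi>0$ such that $G_\xi(z;z^\star)\ge\alpha_\xi\operatorname{dist}^2(z,Z^\star)$ for every $z\in(K\times Y)\cap V$ and every $z^\star\in Z^\star\cap V$. (b) Both of the following error bounds hold. (Primal) There are neighborhoods $V_P$ of $\bar z$ and $V_x$ of $\bar x$ and constants $a_P,b_P>0$ such that, for every $z^\star=(x^\star,y^\star)\in Z^\star\cap V_P$ and every $x\in K\cap V_x$, $$\operatorname{dist}^2(x,X^\star)\le a_P\,E_P(x;z^\star)+b_P\|Ax-b\|^2 .$$ (Dual) There are neighborhoods $V_D$ of $\bar z$ and $V_y$ of $\bar y$ and a constant $\kappa_D>0$ such that, for every $z^\star=(x^\star,y^\star)\in Z^\star\cap V_D$ and every $y\in Y\cap V_y$, $$\operatorname{dist}(y,Y^\star)\le\kappa_D\|R_\xi(y;z^\star)\|_{M_\xi} .$$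
   Context: Problem. $E,Y$ are finite-dimensional Euclidean spaces, $A:E\to Y$ is linear with adjoint $A^*$, $Q:E\to E$ is self-adjoint positive semidefinite, $c\in E$, $b\in Y$, and $K\subseteq E$ is a nonempty closed convex cone with dual cone $K^*=\{s:\langle s,x\rangle\ge 0\ \forall x\in K\}$. The problem is $\min\{\tfrac12\langle x,Qx\rangle+\langle c,x\rangle: Ax=b,\ x\in K\}$, with saddle function $\mathcal L(x,y)=\tfrac12\langle x,Qx\rangle+\langle c,x\rangle+\langle y,b-Ax\rangle$ for $x\in K$, $y\in Y$. The KKT set $Z^\star\subseteq E\times Y$ is the set of $(x,y)$ such that, with $s=Qx+c-A^*y$, one has $Ax=b$, $x\in K$, $s\in K^*$, $\langle x,s\rangle=0$; $X^\star$ and $Y^\star$ are its projections onto $E$ and $Y$. Standing assumption: $Z^\star\neq\emptyset$. Norms are Euclidean (product norm on $E\times Y$), and $\operatorname{dist}$ is Euclidean distance; for a positive semidefinite operator $M$, $\|u\|_M^2=\langle u,Mu\rangle$. Smoothed duality gap. For $z=(x,y),\widehat z=(\widehat x,\widehat y)\in K\times Y$, set $\mathcal Q(z,\widehat z)=\mathcal L(x,\widehat y)-\mathcal L(\widehat x,y)$, and for $\dot z=(\dot x,\dot y)\in E\times Y$, $$G_\xi(z;\dot z)=\sup_{\widehat x\in K,\ \widehat y\in Y}\Big\{\mathcal Q(z,\widehat z)-\tfrac{\xi}{2}\|\widehat x-\dot x\|^2-\tfrac{\xi}{2}\|\widehat y-\dot y\|^2\Big\}.$$ Primal error. For $z^\star=(x^\star,y^\star)\in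 Z^\star$ with $s^\star=Qx^\star+c-A^*y^\star$, $E_P(x;z^\star):=\tfrac12\|x-x^\star\|_Q^2+\langle s^\star,x\rangle$. Dual residual. $M_\xi:=Q+\xi I$, $s^\star(y):=Qx^\star+c-A^*y$, $\Pi_K^{M_\xi}(v):=\arg\min_{u\in K}\tfrac12\|u-v\|_{M_\xi}^2$, and $R_\xi(y;z^\star):=x^\star-\Pi_K^{M_\xi}\big(x^\star-M_\xi^{-1}s^\star(y)\big)$. *)

theory Defs
  imports "HOL-Analysis.Analysis"
begin

text \<open>
  Data of the conic quadratic program
  \<open>min {1/2 \<langle>x, Q x\<rangle> + \<langle>c, x\<rangle> : A x = b, x \<in> K}\<close>.  The hypotheses on the data
  (\<open>A\<close> linear, \<open>Q\<close> self-adjoint positive semidefinite, \<open>K\<close> a nonempty closed convex cone)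
  are not built into the definitions below.  Norm and distance on \<open>'e \<times> 'y\<close> are those of the
  library, i.e. the Euclidean product norm.
\<close>

definition dual_cone :: "'e::real_inner set \<Rightarrow> 'e set" where
  "dual_cone K = {s. \<forall>x\<in>K. 0 \<le> s \<bullet> x}"

definition saddle ::
  "('e::euclidean_space \<Rightarrow> 'y::euclidean_space) \<Rightarrow> 'y \<Rightarrow> ('e \<Rightarrow> 'e) \<Rightarrow> 'e \<Rightarrow> 'e \<Rightarrow> 'y \<Rightarrow> real" where
  "saddle A b Q c x y = 1/2 * (x \<bullet> Q x) + c \<bullet> x + y \<bullet> (b - A x)"

definition slack ::
  "('e::euclidean_space \<Rightarrow> 'y::euclidean_space) \<Rightarrow> ('e \<Rightarrow> 'e) \<Rightarrow> 'e \<Rightarrow> 'e \<Rightarrow> 'y \<Rightarrow> 'e" where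
  "slack A Q c x y = Q x + c - adjoint A y"

definition KKT ::
  "('e::euclidean_space \<Rightarrow> 'y::euclidean_space) \<Rightarrow> 'y \<Rightarrow> ('e \<Rightarrow> 'e) \<Rightarrow> 'e \<Rightarrow> 'e set \<Rightarrow> ('e \<times> 'y) set" where
  "KKT A b Q c K = {(x, y). A x = b \<and> x \<in> K \<and> slack A Q c x y \<in> dual_cone K \<and>
                            x \<bullet> slack A Q c x y = 0}"

definition gap ::
  "('e::euclidean_space \<Rightarrow> 'y::euclidean_space) \<Rightarrow> 'y \<Rightarrow> ('e \<Rightarrow> 'e) \<Rightarrow> 'e \<Rightarrow> 'e \<times> 'y \<Rightarrow> 'e \<times> 'y \<Rightarrow> real" where
  "gap A b Q c z zh = saddle A b Q c (fst z) (snd zh) - saddle A b Q c (fst zh) (snd z)"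

text \<open>
  For \<open>\<xi> > 0\<close> and \<open>Q\<close> positive semidefinite the expression below is a strongly concave quadratic
  in \<open>(xh, yh)\<close>, hence bounded above, so the real-valued supremum over the nonempty set
  \<open>K \<times> UNIV\<close> is the genuine one.
\<close>

definition smoothed_gap ::
  "('e::euclidean_space \<Rightarrow> 'y::euclidean_space) \<Rightarrow> 'y \<Rightarrow> ('e \<Rightarrow> 'e) \<Rightarrow> 'e \<Rightarrow> 'e set \<Rightarrow> real \<Rightarrow>
   'e \<times> 'y \<Rightarrow> 'e \<times> 'y \<Rightarrow> real" where
  "smoothed_gap A b Q c K \<xi> z zd =
     (SUP (xh, yh) \<in> K \<times> UNIV.
        gap A b Q c z (xh, yh) - \<xi>/2 * (norm (xh - fst zd))\<^sup>2 - \<xi>/2 * (norm (yh - snd zd))\<^sup>2)"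

definition op_norm :: "('e::real_inner \<Rightarrow> 'e) \<Rightarrow> 'e \<Rightarrow> real" where
  "op_norm M u = sqrt (u \<bullet> M u)"

definition primal_error ::
  "('e::euclidean_space \<Rightarrow> 'y::euclidean_space) \<Rightarrow> ('e \<Rightarrow> 'e) \<Rightarrow> 'e \<Rightarrow> 'e \<Rightarrow> 'e \<times> 'y \<Rightarrow> real" where
  "primal_error A Q c x zs =
     1/2 * (op_norm Q (x - fst zs))\<^sup>2 + slack A Q c (fst zs) (snd zs) \<bullet> x"

definition reg_op :: "('e::real_vector \<Rightarrow> 'e) \<Rightarrow> real \<Rightarrow> 'e \<Rightarrow> 'e" where
  "reg_op Q \<xi> u = Q u + \<xi> *\<^sub>R u"

text \<open>
  The minimiser chosen by \<^const>\<open>arg_min_on\<close> exists and is unique when \<open>M\<close> is self-adjoint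
  positive definite and \<open>K\<close> is nonempty, closed and convex.
\<close>

definition op_proj :: "('e::real_inner \<Rightarrow> 'e) \<Rightarrow> 'e set \<Rightarrow> 'e \<Rightarrow> 'e" where
  "op_proj M K v = arg_min_on (\<lambda>u. 1/2 * (op_norm M (u - v))\<^sup>2) K"

text \<open>
  The residual depends on \<open>zs\<close> only through its primal component; \<open>inv\<close> is a true inverse because
  \<open>reg_op Q \<xi>\<close> is bijective for \<open>\<xi> > 0\<close> and \<open>Q\<close> linear and positive semidefinite.
\<close>

definition dual_residual ::
  "('e::euclidean_space \<Rightarrow> 'y::euclidean_space) \<Rightarrow> ('e \<Rightarrow> 'e) \<Rightarrow> 'e \<Rightarrow> 'e set \<Rightarrow> real \<Rightarrow>
   'y \<Rightarrow> 'e \<times> 'y \<Rightarrow> 'e" where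
  "dual_residual A Q c K \<xi> y zs =
     fst zs - op_proj (reg_op Q \<xi>) K (fst zs - inv (reg_op Q \<xi>) (slack A Q c (fst zs) y))"

end

theory Submission
  imports Defs
begin

text \<open>
  For a KKT point \<open>zs = (xs, ys)\<close> the supremum defining the smoothed gap separates: maximising
  over \<open>yh\<close> gives \<open>primal_error + \<parallel>A x - b\<parallel>\<^sup>2 / (2\<xi>)\<close>, and maximising over \<open>xh \<in> K\<close> gives a value
  \<open>D\<close> attained at \<open>xh = xs - r\<close>, where \<open>r\<close> is the dual residual and \<open>M = Q + \<xi> I\<close>.  Convexity
  of \<open>K\<close> gives \<open>D \<ge> \<parallel>r\<parallel>\<^sub>M\<^sup>2 / 4\<close>, and since the KKT set is the product of its projections, adding
  the two error bounds yields quadratic growth.  In the other direction \<open>D\<close> is in general not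
  bounded by a multiple of \<open>\<parallel>r\<parallel>\<^sub>M\<^sup>2\<close>; but \<open>D \<le> \<parallel>A\<parallel> dist(y, Y) \<parallel>r\<parallel>\<close> with \<open>Y\<close> the dual solution
  set, so growth, \<open>\<alpha> dist(y, Y)\<^sup>2 \<le> D\<close>, still gives the dual error bound after cancelling one
  factor \<open>dist(y, Y)\<close>.
\<close>

section \<open>Distances to products and projections of sets\<close>

lemma infdist_Times_power2_le:
  fixes x :: "'a::euclidean_space" and y :: "'b::euclidean_space"
  assumes "X \<noteq> {}" "Y \<noteq> {}"
  shows "(infdist (x, y) (X \<times> Y))\<^sup>2 \<le> (infdist x X)\<^sup>2 + (infdist y Y)\<^sup>2"
proof -
  \<comment> \<open>Nearest points are taken in the closures, where they exist; passing to the
    closure leaves \<open>infdist\<close> unchanged.\<close>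
  obtain u where u: "u \<in> closure X" "infdist x (closure X) = dist x u"
    using assms infdist_attains_inf[of "closure X" x] by auto
  obtain v where v: "v \<in> closure Y" "infdist y (closure Y) = dist y v"
    using assms infdist_attains_inf[of "closure Y" y] by auto
  have "infdist (x, y) (closure (X \<times> Y)) \<le> dist (x, y) (u, v)"
    using u v by (intro infdist_le) (simp add: closure_Times)
  then have "infdist (x, y) (X \<times> Y) \<le> dist (x, y) (u, v)"
    by (simp add: infdist_eq_setdist)
  then have "(infdist (x, y) (X \<times> Y))\<^sup>2 \<le> (dist (x, y) (u, v))\<^sup>2"
    by (intro power_mono) (simp_all add: infdist_nonneg)
  then show ?thesis
    using u v unfolding infdist_eq_setdist by (simp add: dist_Pair_Pair)
qed

lemma infdist_fst_le:
  assumes "Z \<noteq> {}"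
  shows "infdist (fst z) (fst ` Z) \<le> infdist z Z"
  using assms unfolding infdist_notempty[OF assms]
  by (intro cINF_greatest) (auto intro!: order_trans[OF infdist_le] dist_fst_le)

lemma infdist_snd_le:
  assumes "Z \<noteq> {}"
  shows "infdist (snd z) (snd ` Z) \<le> infdist z Z"
  using assms unfolding infdist_notempty[OF assms]
  by (intro cINF_greatest) (auto intro!: order_trans[OF infdist_le] dist_snd_le)

text \<open>Dividing by \<open>r\<close> makes \<open>d / r\<close> a lower bound of all distances,
  hence of their infimum, so no nearest point has to be chosen.\<close>

lemma le_mult_infdist:
  assumes "S \<noteq> {}" "0 \<le> r" "\<And>w. w \<in> S \<Longrightarrow> d \<le> r * dist y w"
  shows "d \<le> r * infdist y S"
proof (cases "r = 0")
  case True
  then show ?thesis using assms by auto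
next
  case False
  then have "d / r \<le> infdist y S"
    using assms unfolding infdist_notempty[OF assms(1)]
    by (intro cINF_greatest) (auto simp: divide_le_eq mult.commute)
  then show ?thesis using False assms(2) by (simp add: divide_le_eq mult.commute)
qed

section \<open>The regularised operator \<open>M\<close> and its projection onto
  \<open>K\<close>\<close>

lemma op_norm_power2:
  assumes "0 \<le> u \<bullet> M u"
  shows "(op_norm M u)\<^sup>2 = u \<bullet> M u"
  using assms by (simp add: op_norm_def)

locale conic_qp =
  fixes A :: "'e::euclidean_space \<Rightarrow> 'y::euclidean_space"
    and Q :: "'e \<Rightarrow> 'e"
    and b :: 'y and c :: 'e and K :: "'e set" and \<xi> :: real
  assumes linear_A: "linear A"
    and linear_Q: "linear Q" and adjoint_Q: "adjoint Q = Q"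
    and Q_psd: "\<And>x. 0 \<le> x \<bullet> Q x"
    and convex_cone_K: "convex_cone K" and closed_K: "closed K"
    and \<xi>_pos: "\<xi> > 0"
begin

abbreviation M where "M \<equiv> reg_op Q \<xi>"
abbreviation Z where "Z \<equiv> KKT A b Q c K"
abbreviation R where "R y zs \<equiv> dual_residual A Q c K \<xi> y zs"
abbreviation G where "G z zs \<equiv> smoothed_gap A b Q c K \<xi> z zs"

text \<open>For a KKT point \<open>zs\<close> this is the maximum over \<open>xh\<close> in
  \<open>K\<close> of the part of the smoothed gap that depends on \<open>xh\<close>, evaluated at
  the maximiser \<open>fst zs - R y zs\<close>.\<close>

definition dual_value :: "'y \<Rightarrow> 'e \<times> 'y \<Rightarrow> real" where
  "dual_value y zs = slack A Q c (fst zs) y \<bullet> R y zs - 1/2 * (R y zs \<bullet> M (R y zs))"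

lemma Q_commute: "x \<bullet> Q y = y \<bullet> Q x"
  using adjoint_works[OF linear_Q, of x y] adjoint_Q by (simp add: inner_commute)

lemma adjoint_A: "x \<bullet> adjoint A y = A x \<bullet> y"
  by (rule adjoint_works[OF linear_A])

lemma linear_M: "linear M"
  using linear_Q unfolding reg_op_def [abs_def]
  by (intro linear_compose_add linear_scale_self)

lemma M_commute: "x \<bullet> M y = y \<bullet> M x"
  using Q_commute[of x y] by (simp add: reg_op_def inner_add_right inner_commute)

lemma M_coercive: "\<xi> * (norm u)\<^sup>2 \<le> u \<bullet> M u"
  using Q_psd[of u] by (simp add: reg_op_def inner_add_right power2_norm_eq_inner)

lemma M_psd: "0 \<le> u \<bullet> M u"
  using M_coercive[of u] \<xi>_pos by (meson mult_nonneg_nonneg order.trans less_imp_le zero_le_power2)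

text \<open>Coercivity makes \<open>M\<close> injective, and an injective linear endomorphism in
  finite dimension is onto.\<close>

lemma M_inv: "M (inv M s) = s"
proof -
  have "u = 0" if "M u = 0" for u
    using M_coercive[of u] that \<xi>_pos by (auto simp: mult_le_0_iff)
  then have "inj M"
    using linear_injective_0[OF linear_M] by blast
  then show ?thesis
    using linear_injective_imp_surjective[OF linear_M] by (simp add: surj_f_inv_f)
qed

text \<open>Coercivity confines the minimisation to a closed ball, where compactness gives a
  minimiser.\<close>

lemma op_proj_arg_min:
  shows "op_proj M K v \<in> K"
    and "u \<in> K \<Longrightarrow> 1/2 * ((op_proj M K v - v) \<bullet> M (op_proj M K v - v)) \<le> 1/2 * ((u - v) \<bullet> M (u - v))"
proof -
  define f where "f u = 1/2 * (op_norm M (u - v))\<^sup>2" for u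
  have f: "f u = 1/2 * ((u - v) \<bullet> M (u - v))" for u
    by (simp add: f_def op_norm_power2[OF M_psd])
  obtain a where a: "a \<in> K"
    using convex_cone_K by (auto simp: convex_cone_def)
  \<comment> \<open>The radius solves \<open>\<xi>/2 * r\<^sup>2 = f a\<close>, so coercivity makes
    every point outside the ball worse than \<open>a\<close>.\<close>
  define r where "r = sqrt (2 * f a / \<xi>)"
  have far: "f a < f u" if "r < norm (u - v)" for u
  proof -
    have "2 * f a / \<xi> < (norm (u - v))\<^sup>2"
      using that real_le_rsqrt[of "norm (u - v)" "2 * f a / \<xi>"] unfolding r_def by linarith
    then show ?thesis
      using M_coercive[of "u - v"] \<xi>_pos by (simp add: f divide_less_eq mult.commute)
  qed
  have "compact (K \<inter> cball v r)"
    using closed_K by (simp add: closed_Int_compact)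
  moreover have "a \<in> K \<inter> cball v r"
    using a far[of a] by (auto simp: dist_norm norm_minus_commute not_less[symmetric])
  moreover have "continuous_on (K \<inter> cball v r) f"
    unfolding f by (intro continuous_intros linear_continuous_on_compose[OF _ linear_M])
  ultimately obtain m where m: "m \<in> K \<inter> cball v r" "\<forall>u\<in>K \<inter> cball v r. f m \<le> f u"
    using continuous_attains_inf[of "K \<inter> cball v r" f] by blast
  have "f m \<le> f u" if "u \<in> K" for u
  proof (cases "u \<in> cball v r")
    case True
    then show ?thesis using m that by blast
  next
    case False
    then have "f a < f u"
      by (intro far) (simp add: dist_norm norm_minus_commute)
    moreover have "f m \<le> f a" using m \<open>a \<in> K \<inter> cball v r\<close> by blast
    ultimately show ?thesis by simp
  qed
  then have "is_arg_min f (\<lambda>u. u \<in> K) m"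
    using m by (auto simp: is_arg_min_linorder)
  \<comment> \<open>\<open>arg_min_on\<close> is a Hilbert choice, so existence alone transfers
    minimality to the chosen point.\<close>
  then have "is_arg_min f (\<lambda>u. u \<in> K) (op_proj M K v)"
    unfolding op_proj_def arg_min_on_def arg_min_def f_def[abs_def] by (rule someI)
  then show "op_proj M K v \<in> K"
    and "u \<in> K \<Longrightarrow> 1/2 * ((op_proj M K v - v) \<bullet> M (op_proj M K v - v)) \<le> 1/2 * ((u - v) \<bullet> M (u - v))"
    unfolding is_arg_min_linorder f by auto
qed

section \<open>The residual as maximiser of the dual part\<close>

lemma minus_residual_mem: "fst zs - R y zs \<in> K"
  using op_proj_arg_min(1) by (simp add: dual_residual_def)

text \<open>Completing the square in the \<open>M\<close>-form: up to the constant
  \<open>inv M s \<bullet> s\<close>, the squared \<open>M\<close>-distance to the projected point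
  is -2 times the objective here, so the projection maximises it.\<close>

lemma dual_value_max:
  assumes "u \<in> K"
  shows "slack A Q c (fst zs) y \<bullet> (fst zs - u) - 1/2 * ((fst zs - u) \<bullet> M (fst zs - u))
         \<le> dual_value y zs"
proof -
  define s where "s = slack A Q c (fst zs) y"
  define p where "p = op_proj M K (fst zs - inv M s)"
  have expand: "(w - (fst zs - inv M s)) \<bullet> M (w - (fst zs - inv M s))
      = (fst zs - w) \<bullet> M (fst zs - w) - 2 * (s \<bullet> (fst zs - w)) + inv M s \<bullet> s" for w
  proof -
    define e where "e = fst zs - w"
    have "(inv M s - e) \<bullet> M (inv M s - e) = e \<bullet> M e - 2 * (s \<bullet> e) + inv M s \<bullet> s"
      using M_commute[of "inv M s" e]
      by (simp add: linear_diff[OF linear_M] inner_diff M_inv inner_commute)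
    moreover have "w - (fst zs - inv M s) = inv M s - e" by (simp add: e_def)
    ultimately show ?thesis by (simp only: e_def)
  qed
  have "R y zs = fst zs - p"
    by (simp add: dual_residual_def s_def p_def)
  then show ?thesis
    using op_proj_arg_min(2)[OF assms, of "fst zs - inv M s"]
    unfolding expand dual_value_def by (simp add: s_def p_def)
qed

text \<open>Comparing the maximiser with the midpoint of it and the feasible point \<open>fst zs\<close>.\<close>

lemma dual_value_ge:
  assumes "fst zs \<in> K"
  shows "1/4 * (op_norm M (R y zs))\<^sup>2 \<le> dual_value y zs"
proof -
  let ?u = "(1/2) *\<^sub>R fst zs + (1/2) *\<^sub>R (fst zs - R y zs)"
  have "?u \<in> K"
    using assms minus_residual_mem convex_cone_K
    by (intro convexD) (auto simp: convex_cone_def)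
  moreover have "fst zs - ?u = (1/2) *\<^sub>R R y zs"
    by (simp add: algebra_simps flip: scaleR_add_left)
  \<comment> \<open>With \<open>s\<close> the slack and \<open>r\<close> the residual, optimality
    against the midpoint reads \<open>s \<bullet> r / 2 - r \<bullet> M r / 8 \<le> s \<bullet> r -
    r \<bullet> M r / 2\<close>. Hence \<open>s \<bullet> r\<close> is at least 3/4 of
    \<open>r \<bullet> M r\<close>, which leaves the factor 1/4.\<close>
  ultimately show ?thesis
    using dual_value_max[of ?u zs y]
    by (simp add: dual_value_def linear_scale[OF linear_M] op_norm_power2[OF M_psd])
qed

section \<open>The smoothed gap at a KKT point\<close>

text \<open>Since \<open>A xs = b\<close>, \<open>ys\<close> may be replaced by \<open>y\<close> in
  the first term; the rest is the exact Taylor expansion at \<open>xs\<close>, where the gradient in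
  \<open>x\<close> is the slack.\<close>

lemma saddle_diff_dual:
  assumes "(xs, ys) \<in> Z"
  shows "saddle A b Q c xs ys - saddle A b Q c xh y =
    slack A Q c xs y \<bullet> (xs - xh) - 1/2 * ((xs - xh) \<bullet> Q (xs - xh))"
  using assms Q_commute[of xh xs] adjoint_A[of xs y] adjoint_A[of xh y]
  by (simp add: KKT_def saddle_def slack_def linear_diff[OF linear_Q] inner_diff inner_add
      inner_commute field_simps)

text \<open>The Taylor expansion at \<open>xs\<close> with multiplier \<open>ys\<close>;
  complementarity removes the slack term at \<open>xs\<close>.\<close>

lemma saddle_diff_primal:
  assumes "(xs, ys) \<in> Z"
  shows "saddle A b Q c x ys - saddle A b Q c xs ys = primal_error A Q c x (xs, ys)"
  using assms Q_commute[of x xs] adjoint_A[of xs ys] adjoint_A[of x ys]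
  by (auto simp: KKT_def saddle_def slack_def primal_error_def op_norm_power2[OF Q_psd]
      linear_diff[OF linear_Q] inner_diff inner_add inner_commute field_simps)

text \<open>Inserting the saddle value at \<open>(xs, ys)\<close> separates \<open>xh\<close> from
  \<open>yh\<close>. The square in \<open>yh\<close> is completed, and the proximal term in
  \<open>xh\<close> turns \<open>Q\<close> into \<open>M\<close>.\<close>

lemma gap_decomposition:
  assumes "(xs, ys) \<in> Z"
  shows "gap A b Q c (x, y) (xh, yh) - \<xi>/2 * (norm (xh - xs))\<^sup>2 - \<xi>/2 * (norm (yh - ys))\<^sup>2 =
    primal_error A Q c x (xs, ys) + 1/(2*\<xi>) * (norm (A x - b))\<^sup>2
    - \<xi>/2 * (norm (yh - ys - (1/\<xi>) *\<^sub>R (b - A x)))\<^sup>2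
    + (slack A Q c xs y \<bullet> (xs - xh) - 1/2 * ((xs - xh) \<bullet> M (xs - xh)))"
proof -
  define e d where "e = yh - ys" and "d = b - A x"
  have "e \<bullet> d - \<xi>/2 * (norm e)\<^sup>2 =
      1/(2*\<xi>) * (norm d)\<^sup>2 - \<xi>/2 * (norm (e - (1/\<xi>) *\<^sub>R d))\<^sup>2"
    using \<xi>_pos unfolding power2_norm_eq_inner
    by (simp add: inner_diff inner_commute field_simps)
  then have "(yh - ys) \<bullet> (b - A x) - \<xi>/2 * (norm (yh - ys))\<^sup>2 =
      1/(2*\<xi>) * (norm (b - A x))\<^sup>2 - \<xi>/2 * (norm (yh - ys - (1/\<xi>) *\<^sub>R (b - A x)))\<^sup>2"
    unfolding e_def d_def .
  moreover have "saddle A b Q c x yh = saddle A b Q c x ys + (yh - ys) \<bullet> (b - A x)"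
    by (simp add: saddle_def inner_diff_left)
  moreover have "1/2 * ((xs - xh) \<bullet> M (xs - xh)) =
      1/2 * ((xs - xh) \<bullet> Q (xs - xh)) + \<xi>/2 * (norm (xh - xs))\<^sup>2"
    unfolding norm_minus_commute[of xh xs]
    by (simp add: reg_op_def inner_add_right power2_norm_eq_inner)
  ultimately show ?thesis
    using saddle_diff_dual[OF assms, of xh y] saddle_diff_primal[OF assms, of x]
    unfolding norm_minus_commute[of "A x" b] gap_def fst_conv snd_conv by argo
qed

lemma smoothed_gap_eq:
  assumes "(xs, ys) \<in> Z"
  shows "G (x, y) (xs, ys) =
    primal_error A Q c x (xs, ys) + 1/(2*\<xi>) * (norm (A x - b))\<^sup>2 + dual_value y (xs, ys)"
    (is "_ = ?r")
proof -
  define f where "f = (\<lambda>(xh, yh). gap A b Q c (x, y) (xh, yh)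
    - \<xi>/2 * (norm (xh - xs))\<^sup>2 - \<xi>/2 * (norm (yh - ys))\<^sup>2)"
  \<comment> \<open>The first component attains \<open>dual_value\<close>, the second makes the
    completed square vanish.\<close>
  let ?zm = "(xs - R y (xs, ys), ys + (1/\<xi>) *\<^sub>R (b - A x))"
  have le: "f w \<le> ?r" if "w \<in> K \<times> UNIV" for w
  proof (cases w)
    case (Pair xh yh)
    have "0 \<le> \<xi>/2 * (norm (yh - ys - (1/\<xi>) *\<^sub>R (b - A x)))\<^sup>2"
      using \<xi>_pos by simp
    moreover have "slack A Q c xs y \<bullet> (xs - xh) - 1/2 * ((xs - xh) \<bullet> M (xs - xh))
        \<le> dual_value y (xs, ys)"
      using dual_value_max[of xh "(xs, ys)" y] that Pair by simp
    ultimately show ?thesis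
      unfolding Pair f_def case_prod_conv gap_decomposition[OF assms] by linarith
  qed
  have zm: "?zm \<in> K \<times> UNIV"
    using minus_residual_mem[of "(xs, ys)" y] by simp
  have "f ?zm = ?r"
    unfolding f_def case_prod_conv gap_decomposition[OF assms] by (simp add: dual_value_def)
  moreover have "f ?zm \<le> Sup (f ` (K \<times> UNIV))"
    using le zm by (intro cSUP_upper bdd_aboveI2[where M = ?r]) auto
  moreover have "Sup (f ` (K \<times> UNIV)) \<le> ?r"
    using zm le by (intro cSUP_least) auto
  ultimately show ?thesis
    by (simp add: smoothed_gap_def f_def)
qed

section \<open>Product structure of the KKT set\<close>

text \<open>Minimality of \<open>u\<close> for the form along the direction \<open>Q u\<close>.\<close>

lemma Q_null:
  assumes "u \<bullet> Q u = 0"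
  shows "Q u = 0"
proof (rule ccontr)
  \<comment> \<open>This \<open>t\<close> gives \<open>t * B < a\<close>, which makes the form
    negative at \<open>u - t *\<^sub>R Q u\<close>; the added 1 covers \<open>B = 0\<close>.\<close>
  define a B t where "a = Q u \<bullet> Q u" and "B = Q u \<bullet> Q (Q u)" and "t = a / (B + 1)"
  assume "Q u \<noteq> 0"
  then have "a > 0" by (simp add: a_def)
  moreover have "B \<ge> 0" using Q_psd by (simp add: B_def)
  ultimately have t: "t > 0" "t * B < a"
    by (simp_all add: t_def field_simps)
  have "0 \<le> (u - t *\<^sub>R Q u) \<bullet> Q (u - t *\<^sub>R Q u)" by (rule Q_psd)
  also have "\<dots> = t * (t * B - 2 * a)"
    using assms Q_commute[of u "Q u"]
    by (simp add: a_def B_def linear_diff[OF linear_Q] linear_scale[OF linear_Q] inner_diff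
        algebra_simps)
  also have "\<dots> < 0"
    using t \<open>a > 0\<close> by (intro mult_pos_neg) auto
  finally show False by simp
qed

text \<open>As \<open>A x1 = A x2\<close>, the product \<open>(x1 - x2) \<bullet> (s1 - s2)\<close>
  is a value of the \<open>Q\<close>-form, hence nonnegative; by complementarity it is also minus a
  sum of two nonnegative products. All of these vanish, so \<open>Q x1 = Q x2\<close> and the slack
  depends only on the multiplier.\<close>

lemma KKT_exchange:
  assumes "(x1, y1) \<in> Z" "(x2, y2) \<in> Z"
  shows "(x1, y2) \<in> Z"
proof -
  define s1 s2 where "s1 = slack A Q c x1 y1" and "s2 = slack A Q c x2 y2"
  have k: "A x1 = b" "A x2 = b" "x1 \<in> K" "x2 \<in> K" "s1 \<in> dual_cone K" "s2 \<in> dual_cone K"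
    "x1 \<bullet> s1 = 0" "x2 \<bullet> s2 = 0"
    using assms by (auto simp: KKT_def s1_def s2_def)
  have nonneg: "0 \<le> x2 \<bullet> s1" "0 \<le> x1 \<bullet> s2"
    using k by (auto simp: dual_cone_def inner_commute)
  have "s1 - s2 = Q (x1 - x2) - adjoint A (y1 - y2)"
    by (simp add: s1_def s2_def slack_def linear_diff[OF linear_Q]
        linear_diff[OF adjoint_linear[OF linear_A]])
  then have "(x1 - x2) \<bullet> (s1 - s2) = (x1 - x2) \<bullet> Q (x1 - x2)"
    using k by (simp add: inner_diff_right[of _ "Q (x1 - x2)"] adjoint_A linear_diff[OF linear_A])
  moreover have "(x1 - x2) \<bullet> (s1 - s2) = - (x2 \<bullet> s1) - x1 \<bullet> s2"
    using k by (simp add: inner_diff)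
  ultimately have zero: "x1 \<bullet> s2 = 0" "(x1 - x2) \<bullet> Q (x1 - x2) = 0"
    using nonneg Q_psd[of "x1 - x2"] by linarith+
  have "Q (x1 - x2) = 0"
    using zero(2) by (rule Q_null)
  then have "slack A Q c x1 y2 = s2"
    by (simp add: s2_def slack_def linear_diff[OF linear_Q])
  then show ?thesis
    using k zero by (simp add: KKT_def)
qed

lemma KKT_eq_Times: "Z = fst ` Z \<times> snd ` Z"
  using KKT_exchange by (force simp: image_iff)

section \<open>Bounds for the primal and dual parts of the gap\<close>

lemma primal_error_nonneg:
  assumes "(xs, ys) \<in> Z" "x \<in> K"
  shows "0 \<le> primal_error A Q c x (xs, ys)"
  using assms by (auto simp: primal_error_def KKT_def dual_cone_def)

lemma primal_error_self:
  assumes "(xs, ys) \<in> Z"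
  shows "primal_error A Q c xs (xs, ys) = 0"
  using saddle_diff_primal[OF assms, of xs] by simp

text \<open>By exchange \<open>(xs, w)\<close> is a KKT point, so the slack at \<open>w\<close> has
  nonpositive product with the residual. The slack is affine in the multiplier, and changing
  \<open>w\<close> to \<open>y\<close> contributes exactly the right-hand side; the quadratic term
  is dropped.\<close>

lemma dual_value_le:
  assumes "(xs, ys) \<in> Z" "w \<in> snd ` Z"
  shows "dual_value y (xs, ys) \<le> (w - y) \<bullet> A (R y (xs, ys))"
proof -
  define r where "r = R y (xs, ys)"
  have "(xs, w) \<in> Z"
    using assms KKT_exchange by (metis imageE prod.collapse)
  then have w: "slack A Q c xs w \<in> dual_cone K" "xs \<bullet> slack A Q c xs w = 0"
    by (auto simp: KKT_def)
  have "0 \<le> slack A Q c xs w \<bullet> (xs - r)"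
    using w(1) minus_residual_mem[of "(xs, ys)" y] by (simp add: dual_cone_def r_def)
  then have "slack A Q c xs w \<bullet> r \<le> 0"
    using w(2) by (simp add: inner_diff inner_commute)
  moreover have "slack A Q c xs y \<bullet> r = slack A Q c xs w \<bullet> r + (w - y) \<bullet> A r"
    using adjoint_A[of r y] adjoint_A[of r w]
    by (simp add: slack_def inner_diff inner_add inner_commute)
  ultimately show ?thesis
    using M_psd[of r] by (simp add: dual_value_def r_def)
qed

section \<open>The two implications\<close>

text \<open>The gap at \<open>(x, ys)\<close> sees only the primal error, the gap at \<open>(xs, y)\<close> only the dual one.\<close>

lemma growth_imp_primal:
  assumes V: "(xbar, ybar) \<in> interior V" and \<alpha>: "\<alpha> > 0"
    and growth: "\<And>z zs. \<lbrakk>z \<in> K \<times> UNIV; z \<in> V; zs \<in> Z; zs \<in> V\<rbrakk> \<Longrightarrow>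
      \<alpha> * (infdist z Z)\<^sup>2 \<le> G z zs"
  shows "\<exists>VP Vx aP bP. (xbar, ybar) \<in> interior VP \<and> xbar \<in> interior Vx \<and> aP > 0 \<and> bP > 0 \<and>
        (\<forall>zs \<in> Z \<inter> VP. \<forall>x \<in> K \<inter> Vx. (infdist x (fst ` Z))\<^sup>2 \<le>
             aP * primal_error A Q c x zs + bP * (norm (A x - b))\<^sup>2)"
proof -
  \<comment> \<open>A product neighborhood also contains the mixed point \<open>(x, ys)\<close>, at
    which growth is applied.\<close>
  obtain U W where UW: "open U" "open W" "xbar \<in> U" "ybar \<in> W" "U \<times> W \<subseteq> V"
    using open_prod_elim[OF open_interior V] interior_subset[of V]
    by (metis mem_Sigma_iff order_trans)
  have "(infdist x (fst ` Z))\<^sup>2 \<le>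
      1/\<alpha> * primal_error A Q c x zs + 1/(2*\<xi>*\<alpha>) * (norm (A x - b))\<^sup>2"
    if zs: "zs \<in> Z" "zs \<in> U \<times> W" and x: "x \<in> K" "x \<in> U" for zs x
  proof -
    obtain xs ys where [simp]: "zs = (xs, ys)" by (cases zs)
    \<comment> \<open>With \<open>w = y = ys\<close> the bound is an inner product with 0.\<close>
    have "dual_value ys (xs, ys) \<le> 0"
      using dual_value_le[of xs ys ys ys] zs by (force simp: image_iff)
    then have "G (x, ys) zs \<le> primal_error A Q c x zs + 1/(2*\<xi>) * (norm (A x - b))\<^sup>2"
      using smoothed_gap_eq[of xs ys x ys] zs by simp
    moreover have "\<alpha> * (infdist (x, ys) Z)\<^sup>2 \<le> G (x, ys) zs"
      using UW zs x by (intro growth) auto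
    moreover have "\<alpha> * (infdist x (fst ` Z))\<^sup>2 \<le> \<alpha> * (infdist (x, ys) Z)\<^sup>2"
      using infdist_fst_le[of Z "(x, ys)"] zs \<alpha>
      by (intro mult_left_mono power_mono) (auto simp: infdist_nonneg)
    ultimately have "\<alpha> * (infdist x (fst ` Z))\<^sup>2 \<le>
        primal_error A Q c x zs + 1/(2*\<xi>) * (norm (A x - b))\<^sup>2" by linarith
    then show ?thesis
      using \<alpha> \<xi>_pos by (simp add: field_simps)
  qed
  moreover have "(xbar, ybar) \<in> interior (U \<times> W)" "xbar \<in> interior U"
    using UW by (simp_all add: interior_open open_Times)
  moreover have "1/\<alpha> > 0" "1/(2*\<xi>*\<alpha>) > 0"
    using \<alpha> \<xi>_pos by simp_all
  ultimately show ?thesis by (metis IntE)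
qed

lemma growth_imp_dual:
  assumes V: "(xbar, ybar) \<in> interior V" and \<alpha>: "\<alpha> > 0"
    and growth: "\<And>z zs. \<lbrakk>z \<in> K \<times> UNIV; z \<in> V; zs \<in> Z; zs \<in> V\<rbrakk> \<Longrightarrow>
      \<alpha> * (infdist z Z)\<^sup>2 \<le> G z zs"
  shows "\<exists>VD Vy \<kappa>. (xbar, ybar) \<in> interior VD \<and> ybar \<in> interior Vy \<and> \<kappa> > 0 \<and>
        (\<forall>zs \<in> Z \<inter> VD. \<forall>y \<in> Vy. infdist y (snd ` Z) \<le> \<kappa> * op_norm M (R y zs))"
proof -
  obtain U W where UW: "open U" "open W" "xbar \<in> U" "ybar \<in> W" "U \<times> W \<subseteq> V"
    using open_prod_elim[OF open_interior V] interior_subset[of V]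
    by (metis mem_Sigma_iff order_trans)
  obtain B where B: "B > 0" "\<And>x. norm (A x) \<le> B * norm x"
    using linear_bounded_pos[OF linear_A] by blast
  \<comment> \<open>\<open>B\<close> bounds the norm of \<open>A\<close>, and
    \<open>sqrt \<xi>\<close> converts the Euclidean norm of the residual into its
    \<open>M\<close>-norm.\<close>
  have "infdist y (snd ` Z) \<le> B / (\<alpha> * sqrt \<xi>) * op_norm M (R y zs)"
    if zs: "zs \<in> Z" "zs \<in> U \<times> W" and y: "y \<in> W" for zs y
  proof -
    obtain xs ys where [simp]: "zs = (xs, ys)" by (cases zs)
    define r where "r = R y zs"
    define d where "d = infdist y (snd ` Z)"
    have "\<alpha> * d\<^sup>2 \<le> \<alpha> * (infdist (xs, y) Z)\<^sup>2"
      using infdist_snd_le[of Z "(xs, y)"] zs \<alpha> unfolding d_def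
      by (intro mult_left_mono power_mono) (auto simp: infdist_nonneg)
    also have "\<dots> \<le> G (xs, y) zs"
      using UW zs y by (intro growth) (auto simp: KKT_def)
    also have "\<dots> = dual_value y zs"
      using smoothed_gap_eq[of xs ys xs y] primal_error_self[of xs ys] zs by (simp add: KKT_def)
    also have "\<dots> \<le> (B * norm r) * d"
      unfolding d_def
    proof (rule le_mult_infdist)
      fix w assume w: "w \<in> snd ` Z"
      have "dual_value y zs \<le> (w - y) \<bullet> A r"
        using dual_value_le[of xs ys w y] w zs by (simp add: r_def)
      also have "\<dots> \<le> norm (w - y) * norm (A r)"
        by (rule norm_cauchy_schwarz)
      also have "\<dots> \<le> dist y w * (B * norm r)"
        using B(2)[of r] by (intro mult_mono) (auto simp: dist_norm norm_minus_commute)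
      finally show "dual_value y zs \<le> (B * norm r) * dist y w"
        by (simp add: mult.commute)
    qed (use zs B in auto)
    finally have "\<alpha> * d * d \<le> (B * norm r) * d"
      by (simp add: power2_eq_square)
    moreover have "0 \<le> d"
      by (simp add: d_def infdist_nonneg)
    ultimately have "\<alpha> * d \<le> B * norm r"
      using B(1) by (cases "d = 0") simp_all
    moreover have "sqrt \<xi> * norm r \<le> op_norm M r"
      unfolding op_norm_def using M_coercive[of r] \<xi>_pos
      by (intro real_le_rsqrt) (simp add: power_mult_distrib)
    then have "B * norm r * sqrt \<xi> \<le> B * op_norm M r"
      using B(1) by (simp add: mult.commute)
    moreover have "\<alpha> * d * sqrt \<xi> \<le> B * norm r * sqrt \<xi>" if "\<alpha> * d \<le> B * norm r"
      using that \<xi>_pos by (intro mult_right_mono) auto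
    ultimately have "d * (\<alpha> * sqrt \<xi>) \<le> B * op_norm M r"
      by (simp add: ac_simps)
    then show ?thesis
      using \<alpha> \<xi>_pos by (simp add: d_def r_def field_simps)
  qed
  moreover have "(xbar, ybar) \<in> interior (U \<times> W)" "ybar \<in> interior W"
    using UW by (simp_all add: interior_open open_Times)
  moreover have "B / (\<alpha> * sqrt \<xi>) > 0"
    using \<alpha> \<xi>_pos B(1) by simp
  ultimately show ?thesis by (metis IntE)
qed

lemma error_bounds_imp_growth:
  assumes P: "(xbar, ybar) \<in> interior VP" "xbar \<in> interior Vx" "aP > 0" "bP > 0"
    "\<And>zs x. \<lbrakk>zs \<in> Z; zs \<in> VP; x \<in> K; x \<in> Vx\<rbrakk> \<Longrightarrow> (infdist x (fst ` Z))\<^sup>2 \<le>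
        aP * primal_error A Q c x zs + bP * (norm (A x - b))\<^sup>2"
    and D: "(xbar, ybar) \<in> interior VD" "ybar \<in> interior Vy" "\<kappa> > 0"
    "\<And>zs y. \<lbrakk>zs \<in> Z; zs \<in> VD; y \<in> Vy\<rbrakk> \<Longrightarrow> infdist y (snd ` Z) \<le> \<kappa> * op_norm M (R y zs)"
  shows "\<exists>V \<alpha>. (xbar, ybar) \<in> interior V \<and> \<alpha> > 0 \<and>
        (\<forall>z \<in> (K \<times> UNIV) \<inter> V. \<forall>zs \<in> Z \<inter> V. G z zs \<ge> \<alpha> * (infdist z Z)\<^sup>2)"
proof -
  \<comment> \<open>A common bound for the weights of the three gap terms: \<open>2 * \<xi>\<close>
    undoes the factor of the feasibility term, and 4 inverts the 1/4 of
    \<open>dual_value_ge\<close>. The growth constant is \<open>1/C\<close>.\<close>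
  define C where "C = aP + 2 * \<xi> * bP + 4 * \<kappa>\<^sup>2"
  have C: "C > 0" "aP \<le> C" "2 * \<xi> * bP \<le> C" "4 * \<kappa>\<^sup>2 \<le> C"
    using P D \<xi>_pos by (auto simp: C_def add_pos_pos)
  define V where "V = VP \<inter> VD \<inter> (Vx \<times> Vy)"
  have "1/C * (infdist z Z)\<^sup>2 \<le> G z zs"
    if z: "z \<in> K \<times> UNIV" "z \<in> V" and zs: "zs \<in> Z" "zs \<in> V" for z zs
  proof -
    obtain x y where [simp]: "z = (x, y)" by (cases z)
    obtain xs ys where [simp]: "zs = (xs, ys)" by (cases zs)
    define E F H where "E = primal_error A Q c x zs" and "F = 1/(2*\<xi>) * (norm (A x - b))\<^sup>2"
      and "H = dual_value y zs"
    have nonneg: "0 \<le> E" "0 \<le> F" "0 \<le> op_norm M (R y zs)"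
      using primal_error_nonneg[of xs ys x] z zs \<xi>_pos M_psd
      by (auto simp: E_def F_def op_norm_def)
    have H: "1/4 * (op_norm M (R y zs))\<^sup>2 \<le> H"
      unfolding H_def using zs by (intro dual_value_ge) (simp add: KKT_def)
    then have "0 \<le> H"
      using zero_le_power2[of "op_norm M (R y zs)"] by linarith
    have "(infdist z Z)\<^sup>2 \<le> (infdist x (fst ` Z))\<^sup>2 + (infdist y (snd ` Z))\<^sup>2"
      using infdist_Times_power2_le[of "fst ` Z" "snd ` Z" x y] zs
      unfolding KKT_eq_Times[symmetric] by auto
    also have "(infdist x (fst ` Z))\<^sup>2 \<le> aP * E + (2 * \<xi> * bP) * F"
      using P(5)[of zs x] z zs \<xi>_pos by (auto simp: E_def F_def V_def)
    also have "(infdist y (snd ` Z))\<^sup>2 \<le> (\<kappa> * op_norm M (R y zs))\<^sup>2"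
      using D(4)[of zs y] z zs by (intro power_mono) (auto simp: V_def infdist_nonneg)
    also have "\<dots> \<le> (4 * \<kappa>\<^sup>2) * H"
      using H D(3) by (simp add: power_mult_distrib)
    finally have "(infdist z Z)\<^sup>2 \<le> aP * E + (2 * \<xi> * bP) * F + (4 * \<kappa>\<^sup>2) * H"
      by simp
    also have "\<dots> \<le> C * E + C * F + C * H"
      using C nonneg \<open>0 \<le> H\<close> by (intro add_mono mult_right_mono)
    also have "\<dots> = C * G z zs"
      using smoothed_gap_eq[of xs ys x y] zs by (simp add: E_def F_def H_def distrib_left)
    finally show ?thesis
      using C(1) by (simp add: divide_le_eq mult.commute)
  qed
  moreover have "(xbar, ybar) \<in> interior V"
    using P D by (simp add: V_def interior_Times)
  moreover have "1/C > 0" using C(1) by simp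
  ultimately show ?thesis by (metis IntE)
qed

end

theorem theorem3p4:
  fixes A :: "'e::euclidean_space \<Rightarrow> 'y::euclidean_space"
    and Q :: "'e \<Rightarrow> 'e"
    and b :: 'y and c :: 'e and K :: "'e set"
    and \<xi> :: real and xbar :: 'e and ybar :: 'y
  assumes "linear A"
    and "linear Q" and "adjoint Q = Q" and "\<And>x. 0 \<le> x \<bullet> Q x"
    and "convex_cone K" and "closed K"
    and "\<xi> > 0"
    and "(xbar, ybar) \<in> KKT A b Q c K"
  shows
    "(\<exists>V \<alpha>. (xbar, ybar) \<in> interior V \<and> \<alpha> > 0 \<and>
        (\<forall>z \<in> (K \<times> UNIV) \<inter> V. \<forall>zs \<in> KKT A b Q c K \<inter> V.
           smoothed_gap A b Q c K \<xi> z zs \<ge> \<alpha> * (infdist z (KKT A b Q c K))\<^sup>2))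
     \<longleftrightarrow>
     ((\<exists>VP Vx aP bP. (xbar, ybar) \<in> interior VP \<and> xbar \<in> interior Vx \<and> aP > 0 \<and> bP > 0 \<and>
        (\<forall>zs \<in> KKT A b Q c K \<inter> VP. \<forall>x \<in> K \<inter> Vx.
           (infdist x (fst ` KKT A b Q c K))\<^sup>2 \<le>
             aP * primal_error A Q c x zs + bP * (norm (A x - b))\<^sup>2))
      \<and>
      (\<exists>VD Vy \<kappa>. (xbar, ybar) \<in> interior VD \<and> ybar \<in> interior Vy \<and> \<kappa> > 0 \<and>
        (\<forall>zs \<in> KKT A b Q c K \<inter> VD. \<forall>y \<in> Vy.
           infdist y (snd ` KKT A b Q c K) \<le>
             \<kappa> * op_norm (reg_op Q \<xi>) (dual_residual A Q c K \<xi> y zs))))"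
proof -
  interpret conic_qp A Q b c K \<xi>
    by (rule conic_qp.intro) (fact assms)+
  show ?thesis (is "?growth \<longleftrightarrow> ?primal \<and> ?dual")
  proof
    assume ?growth
    then obtain V \<alpha> where "(xbar, ybar) \<in> interior V" "\<alpha> > 0"
      "\<And>z zs. \<lbrakk>z \<in> K \<times> UNIV; z \<in> V; zs \<in> Z; zs \<in> V\<rbrakk> \<Longrightarrow> \<alpha> * (infdist z Z)\<^sup>2 \<le> G z zs"
      by blast
    then show "?primal \<and> ?dual"
      by (intro conjI growth_imp_primal growth_imp_dual)
  next
    assume "?primal \<and> ?dual"
    then obtain VP Vx aP bP VD Vy \<kappa> where
      "(xbar, ybar) \<in> interior VP" "xbar \<in> interior Vx" "aP > 0" "bP > 0"
      "\<And>zs x. \<lbrakk>zs \<in> Z; zs \<in> VP; x \<in> K; x \<in> Vx\<rbrakk> \<Longrightarrow> (infdist x (fst ` Z))\<^sup>2 \<le>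
        aP * primal_error A Q c x zs + bP * (norm (A x - b))\<^sup>2"
      "(xbar, ybar) \<in> interior VD" "ybar \<in> interior Vy" "\<kappa> > 0"
      "\<And>zs y. \<lbrakk>zs \<in> Z; zs \<in> VD; y \<in> Vy\<rbrakk> \<Longrightarrow>
        infdist y (snd ` Z) \<le> \<kappa> * op_norm M (R y zs)"
      by blast
    then show ?growth
      by (rule error_bounds_imp_growth)
  qed
qed

end
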